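(* Let $f:\mathbb{R}^n\to\mathbb{R}$ and $G:\mathbb{R}^n\to S^p$ be twice continuously differentiable, let $\bar x$ be a stationary point of the problem $\min f(x)$ s.t. $G(x)\in S^p_+$, and let $\bar y\in\Lambda(\bar x)$ be an associated Lagrange multiplier. If the second order sufficient condition with respect to $\bar y$, $$\langle d,\nabla^2_{xx}L(\bar x,\bar y)d\rangle-\sigma\big(\bar y,T^2_{S^p_+}(G(\bar x),G'(\bar x)d)\big)>0\qquad\forall d\in C(\bar x)\setminus\{0\},$$ holds, then there are numbers $\varepsilon>0$, $\ell>0$ and neighborhoods $U$ of $0\in\mathbb{R}^n$ and $W$ of $0\in S^p$ such that for any $(p_1,p_2)\in U\times W$ and any $(x_{p_1p_2},y_{p_1p_2})\in S_{\rm KKT}(p_1,p_2)\cap\mathbb{B}_\varepsilon(\bar x,\bar y)$, $$\|x_{p_1p_2}-\bar x\|\le\ell\big(\|p_1\|+\|p_2\|+\|y_{p_1p_2}-\bar y\|\big).$$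
   Context: $S^p$ is the space of real symmetric $p\times p$ matrices with the trace inner product; $S^p_+$ (resp. $S^p_-$) is the cone of positive (resp. negative) semidefinite matrices. $L(x,y)=f(x)+\langle y,G(x)\rangle$ for $(x,y)\in\mathbb{R}^n\times S^p$. $G'(\bar x):\mathbb{R}^n\to S^p$ is the derivative. $N(x;\Omega)$ is the normal cone of convex analysis to the convex set $\Omega$ at $x\in\Omega$, and empty if $x\notin\Omega$. $\mathbb{B}_\varepsilon(\cdot)$ is the ball of radius $\varepsilon$. For feasible $\bar x$, $\Lambda(\bar x)=\{y\in S^p:\nabla_xL(\bar x,y)=0,\ y\in N(G(\bar x);S^p_+)\}$; a feasible $\bar x$ is stationary if $\Lambda(\bar x)\neq\emptyset$. For a set $\Omega$ in a finite-dimensional Hilbert space and $z\in\Omega$, the tangent cone is $T(z;\Omega)=\limsup_{t\downarrow0}(\Omega-z)/t$ (outer limit). The critical cone is $C(\bar x)=\{d\in\mathbb{R}^n:G'(\bar x)d\in T(G(\bar x);S^p_+),\ f'(\bar x)d\le0\}$. $T^2_{S^p_+}(A,H)=\{W\in S^p:\operatorname{dist}(A+tH+\tfrac12t^2W,S^p_+)=o(t^2),\ t\downarrow0\}$ is the second order tangent set to $S^p_+$ at $A$ in the direction $H$, and $\sigma(y,\mathcal T)=\sup_{W\in\mathcal T}\langle y,W\rangle$ is the support function of $\mathcal T$. For $(p_1,p_2)\in\mathbb{R}^n\times S^p$, the solution map of the canonically perturbed KKT system is $$S_{\rm KKT}(p_1,p_2)=\{(x,y)\in\mathbb{R}^n\times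 S^p:\ p_1=\nabla_xL(x,y),\ p_2\in -G(x)+N(y;S^p_-)\}.$$ *)

theory Defs
  imports "HOL-Analysis.Analysis"
begin

section \<open>Smoothness and gradients\<close>

definition twice_cont_diff :: "('a::real_normed_vector \<Rightarrow> 'b::real_normed_vector) \<Rightarrow> bool" where
  "twice_cont_diff F \<longleftrightarrow>
     (\<exists>(F' :: 'a \<Rightarrow> 'a \<Rightarrow>\<^sub>L 'b) (F'' :: 'a \<Rightarrow> 'a \<Rightarrow>\<^sub>L ('a \<Rightarrow>\<^sub>L 'b)).
        (\<forall>x. (F has_derivative blinfun_apply (F' x)) (at x)) \<and>
        (\<forall>x. (F' has_derivative blinfun_apply (F'' x)) (at x)) \<and>
        continuous_on UNIV F'')"

definition grad :: "('a::real_inner \<Rightarrow> real) \<Rightarrow> 'a \<Rightarrow> 'a" where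
  "grad f x = (THE D. GDERIV f x :> D)"

lemma grad_eq:
  assumes "GDERIV f x :> D"
  shows "grad f x = D"
  unfolding grad_def
proof (rule the_equality, rule assms)
  fix E assume "GDERIV f x :> E"
  then have "(\<lambda>h. h \<bullet> E) = (\<lambda>h. h \<bullet> D)"
    using assms unfolding gderiv_def by (metis has_derivative_unique)
  then have "E \<bullet> (E - D) = D \<bullet> (E - D)" by (metis inner_commute)
  then show "E = D"
    by (metis inner_commute inner_diff_left inner_eq_zero_iff right_minus_eq)
qed

definition hess :: "('a::real_inner \<Rightarrow> real) \<Rightarrow> 'a \<Rightarrow> 'a \<Rightarrow> 'a" where
  "hess f x = frechet_derivative (grad f) (at x)"

section \<open>Symmetric matrices\<close>

text \<open>
  The space of symmetric matrices is the linear subspace \<open>sym_mats\<close> of all square matrices.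
  The library inner product on matrices restricts to the trace inner product on it, and the
  library norm to the Frobenius norm.
\<close>

definition sym_mats :: "(real^'p^'p) set" where
  "sym_mats = {A. transpose A = A}"

lemma subspace_sym_mats: "subspace sym_mats"
  by (auto simp: subspace_def sym_mats_def transpose_def vec_eq_iff)

lemma inner_sym_mats_eq_trace:
  assumes "A \<in> sym_mats"
  shows "A \<bullet> B = trace (A ** B)"
proof -
  have s: "A $ i $ j = A $ j $ i" for i j
    using assms unfolding sym_mats_def by (metis (mono_tags) mem_Collect_eq transpose_def vec_lambda_beta)
  have "A \<bullet> B = (\<Sum>i\<in>UNIV. \<Sum>j\<in>UNIV. A $ i $ j * B $ i $ j)"
    by (simp add: inner_vec_def)
  also have "\<dots> = (\<Sum>j\<in>UNIV. \<Sum>i\<in>UNIV. A $ i $ j * B $ i $ j)"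
    by (rule sum.swap)
  also have "\<dots> = trace (A ** B)"
    unfolding trace_def matrix_matrix_mult_def by (simp add: s)
  finally show ?thesis .
qed

definition psd_cone :: "(real^'p^'p) set" where
  "psd_cone = {A \<in> sym_mats. \<forall>v. v \<bullet> (A *v v) \<ge> 0}"

definition nsd_cone :: "(real^'p^'p) set" where
  "nsd_cone = {A \<in> sym_mats. \<forall>v. v \<bullet> (A *v v) \<le> 0}"

section \<open>Variational notions\<close>

text \<open>
  The first argument \<open>E\<close> is the Hilbert space in which the normal cone is taken. It must be
  explicit because the normal cone to a set of symmetric matrices in the space of all square
  matrices would additionally contain every skew-symmetric matrix.
\<close>

definition normal_cone :: "'a::real_inner set \<Rightarrow> 'a \<Rightarrow> 'a set \<Rightarrow> 'a set" where
  "normal_cone E x \<Omega> = {y \<in> E. x \<in> \<Omega> \<and> (\<forall>z\<in>\<Omega>. y \<bullet> (z - x) \<le> 0)}"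

text \<open>The Painleve--Kuratowski outer limit of \<open>M t\<close> as \<open>t\<close> decreases to \<open>0\<close>.\<close>

definition outer_limit :: "(real \<Rightarrow> 'a::topological_space set) \<Rightarrow> 'a set" where
  "outer_limit M = {w. \<exists>(t :: nat \<Rightarrow> real) u.
     (\<forall>k. t k > 0) \<and> t \<longlonglongrightarrow> 0 \<and> u \<longlonglongrightarrow> w \<and> (\<forall>k. u k \<in> M (t k))}"

definition tangent_cone :: "'a::real_normed_vector \<Rightarrow> 'a set \<Rightarrow> 'a set" where
  "tangent_cone z \<Omega> = outer_limit (\<lambda>t. (\<lambda>x. (x - z) /\<^sub>R t) ` \<Omega>)"

definition second_order_tangent_set :: "real^'p^'p \<Rightarrow> real^'p^'p \<Rightarrow> (real^'p^'p) set" where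
  "second_order_tangent_set A H =
     {W \<in> sym_mats.
        (\<lambda>t. infdist (A + t *\<^sub>R H + (t\<^sup>2 / 2) *\<^sub>R W) psd_cone) \<in> o[at_right 0](\<lambda>t. t\<^sup>2)}"

text \<open>The support function is extended-real valued; its value on the empty set is \<open>-\<infinity>\<close>.\<close>

definition support_fun :: "'a::real_inner \<Rightarrow> 'a set \<Rightarrow> ereal" where
  "support_fun y T = (SUP W\<in>T. ereal (y \<bullet> W))"

section \<open>The semidefinite program\<close>

text \<open>
  All notions below refer to the problem of minimising \<open>f x\<close> subject to \<open>G x \<in> psd_cone\<close>,
  where \<open>G\<close> is meant to take values in \<open>sym_mats\<close>.
\<close>

definition lagrangian ::
  "(real^'n \<Rightarrow> real) \<Rightarrow> (real^'n \<Rightarrow> real^'p^'p) \<Rightarrow> real^'n \<Rightarrow> real^'p^'p \<Rightarrow> real" where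
  "lagrangian f G x y = f x + y \<bullet> G x"

definition multipliers ::
  "(real^'n \<Rightarrow> real) \<Rightarrow> (real^'n \<Rightarrow> real^'p^'p) \<Rightarrow> real^'n \<Rightarrow> (real^'p^'p) set" where
  "multipliers f G x =
     {y \<in> sym_mats. grad (\<lambda>x. lagrangian f G x y) x = 0 \<and> y \<in> normal_cone sym_mats (G x) psd_cone}"

definition stationary ::
  "(real^'n \<Rightarrow> real) \<Rightarrow> (real^'n \<Rightarrow> real^'p^'p) \<Rightarrow> real^'n \<Rightarrow> bool" where
  "stationary f G x \<longleftrightarrow> G x \<in> psd_cone \<and> multipliers f G x \<noteq> {}"

definition critical_cone ::
  "(real^'n \<Rightarrow> real) \<Rightarrow> (real^'n \<Rightarrow> real^'p^'p) \<Rightarrow> real^'n \<Rightarrow> (real^'n) set" where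
  "critical_cone f G x =
     {d. frechet_derivative G (at x) d \<in> tangent_cone (G x) psd_cone \<and>
         frechet_derivative f (at x) d \<le> 0}"

definition second_order_sufficient ::
  "(real^'n \<Rightarrow> real) \<Rightarrow> (real^'n \<Rightarrow> real^'p^'p) \<Rightarrow> real^'n \<Rightarrow> real^'p^'p \<Rightarrow> bool" where
  "second_order_sufficient f G x y \<longleftrightarrow>
     (\<forall>d \<in> critical_cone f G x - {0}.
        ereal (d \<bullet> hess (\<lambda>x. lagrangian f G x y) x d)
          - support_fun y (second_order_tangent_set (G x) (frechet_derivative G (at x) d)) > 0)"

definition S_KKT ::
  "(real^'n \<Rightarrow> real) \<Rightarrow> (real^'n \<Rightarrow> real^'p^'p) \<Rightarrow> real^'n \<Rightarrow> real^'p^'p \<Rightarrow>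
     ((real^'n) \<times> (real^'p^'p)) set" where
  "S_KKT f G p1 p2 =
     {(x, y). y \<in> sym_mats \<and> p1 = grad (\<lambda>x. lagrangian f G x y) x \<and>
              p2 \<in> (\<lambda>v. - G x + v) ` normal_cone sym_mats y nsd_cone}"

end

theory Submission
  imports Defs
begin

text \<open>
  If the estimate fails, there are perturbed KKT points with \<open>t = \<parallel>x - xbar\<parallel>\<close> tending to \<open>0\<close>,
  \<open>(x - xbar) / t\<close> tending to some \<open>d\<close>, and \<open>p1\<close>, \<open>p2\<close>, \<open>y - ybar\<close> all of order \<open>o(t)\<close>. Put
  \<open>A = G(xbar)\<close>, \<open>H = G'(xbar) d\<close> and \<open>Z = G(x) + p2\<close>. Expanding the stationarity equation to
  first order makes the Hessian of the Lagrangian vanish at \<open>d\<close>, and expanding the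
  complementarity relation \<open>Z y = 0\<close> gives \<open>H ybar = 0\<close>. Hence \<open>d\<close> is critical, and the
  sigma term is nonnegative because a large multiple of the projection onto the kernel of \<open>ybar\<close>
  is a second order tangent orthogonal to \<open>ybar\<close>. This contradicts the second order condition.
\<close>

section \<open>Matrices\<close>

lemma matrix_add_rdistrib: "(A + B) ** C = A ** C + B ** C"
  by (vector matrix_matrix_mult_def sum.distrib[symmetric] field_simps)

lemma inner_transpose:
  fixes A B :: "real^'n^'m"
  shows "transpose A \<bullet> transpose B = A \<bullet> B"
  unfolding inner_vec_def transpose_def by simp (rule sum.swap)

lemma inner_matrix_mult_right:
  fixes A :: "real^'n^'m" and B :: "real^'k^'m" and C :: "real^'n^'k"
  shows "A \<bullet> (B ** C) = (transpose B ** A) \<bullet> C"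
proof -
  have "A \<bullet> (B ** C) = (\<Sum>i\<in>UNIV. \<Sum>j\<in>UNIV. \<Sum>k\<in>UNIV. A $ i $ j * (B $ i $ k * C $ k $ j))"
    by (simp add: inner_vec_def matrix_matrix_mult_def sum_distrib_left)
  also have "\<dots> = (\<Sum>i\<in>UNIV. \<Sum>k\<in>UNIV. \<Sum>j\<in>UNIV. A $ i $ j * (B $ i $ k * C $ k $ j))"
    by (intro sum.cong refl sum.swap)
  also have "\<dots> = (\<Sum>k\<in>UNIV. \<Sum>i\<in>UNIV. \<Sum>j\<in>UNIV. A $ i $ j * (B $ i $ k * C $ k $ j))"
    by (rule sum.swap)
  also have "\<dots> = (\<Sum>k\<in>UNIV. \<Sum>j\<in>UNIV. \<Sum>i\<in>UNIV. A $ i $ j * (B $ i $ k * C $ k $ j))"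
    by (intro sum.cong refl sum.swap)
  also have "\<dots> = (transpose B ** A) \<bullet> C"
    by (simp add: inner_vec_def matrix_matrix_mult_def transpose_def sum_distrib_left sum_distrib_right mult_ac)
  finally show ?thesis .
qed

text \<open>For small \<open>s > 0\<close> a positive linear term would dominate the quadratic one.
  This extracts first-order conditions from inequalities along one-parameter curves.\<close>

lemma quadratic_coeff_nonpos:
  fixes a c :: real
  assumes "\<And>s. 2 * s * a + s\<^sup>2 * c \<le> 0"
  shows "a \<le> 0"
proof (rule ccontr)
  assume "\<not> a \<le> 0"
  then have a: "a > 0" by simp
  define s where "s = a / (\<bar>c\<bar> + 1)"
  have s: "s > 0" using a by (simp add: s_def add_nonneg_pos)
  have "s * \<bar>c\<bar> \<le> a"
    using a by (simp add: s_def field_simps add_nonneg_pos)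
  moreover have "- (s * \<bar>c\<bar>) \<le> s * c"
    using s by (metis abs_ge_minus_self abs_mult abs_of_pos minus_le_iff)
  ultimately have "2 * a + s * c > 0" using a by linarith
  then have "s * (2 * a + s * c) > 0" using s by simp
  with assms[of s] show False by (simp add: power2_eq_square algebra_simps)
qed

lemma sym_mats_inner_commute:
  assumes "A \<in> sym_mats"
  shows "u \<bullet> (A *v v) = v \<bullet> (A *v u)"
proof -
  have "transpose A = A" using assms by (simp add: sym_mats_def)
  then show ?thesis
    by (metis dot_lmul_matrix inner_commute transpose_matrix_vector)
qed

text \<open>
  The congruences \<open>M\<^sup>T Z M\<close> with \<open>M\<close> close to the identity move \<open>Z\<close> in all directions
  \<open>M\<^sup>T Z + Z M\<close>, and stationarity of \<open>y\<close> along these directions is \<open>Z y = 0\<close>. This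
  replaces a spectral decomposition.
\<close>

lemma mult_eq_0_if_congruences_le:
  fixes y Z :: "real^'p^'p"
  assumes y: "y \<in> sym_mats" and Z: "Z \<in> sym_mats"
    and le: "\<And>M. y \<bullet> (transpose M ** Z ** M - Z) \<le> 0"
  shows "Z ** y = 0"
proof -
  have ty: "transpose y = y" and tZ: "transpose Z = Z"
    using y Z by (auto simp: sym_mats_def)
  \<comment> \<open>With this direction both first-order terms of the congruence equal
    \<open>M \<bullet> M\<close>, so the sign condition forces \<open>M = 0\<close>.\<close>
  define M where "M = Z ** y"
  have 1: "y \<bullet> (Z ** M) = M \<bullet> M"
    by (simp add: inner_matrix_mult_right tZ M_def)
  have 2: "y \<bullet> (transpose M ** Z) = M \<bullet> M"
    using inner_transpose[of y "transpose M ** Z"] 1 by (simp add: matrix_transpose_mul ty tZ)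
  have "M \<bullet> M \<le> 0"
  proof (rule quadratic_coeff_nonpos)
    fix s :: real
    have "transpose (mat 1 + s *\<^sub>R M) ** Z ** (mat 1 + s *\<^sub>R M) - Z
        = s *\<^sub>R (transpose M ** Z) + s *\<^sub>R (Z ** M) + s\<^sup>2 *\<^sub>R (transpose M ** Z ** M)"
    proof -
      have "transpose (mat 1 + s *\<^sub>R M) = mat 1 + s *\<^sub>R transpose M"
        by (auto simp: transpose_def vec_eq_iff mat_def)
      moreover have "(mat 1 + s *\<^sub>R A) ** B = B + s *\<^sub>R (A ** B)"
        "B ** (mat 1 + s *\<^sub>R A) = B + s *\<^sub>R (B ** A)" for A B :: "real^'p^'p"
        by (simp_all add: matrix_add_ldistrib matrix_add_rdistrib matrix_scalar_ac flip: scalar_matrix_assoc)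
      ultimately show ?thesis
        by (simp add: matrix_add_rdistrib matrix_mul_assoc power2_eq_square scaleR_add_right
            flip: scalar_matrix_assoc)
    qed
    then show "2 * s * (M \<bullet> M) + s\<^sup>2 * (y \<bullet> (transpose M ** Z ** M)) \<le> 0"
      using le[of "mat 1 + s *\<^sub>R M"] 1 2 by (simp add: inner_add_right)
  qed
  then show ?thesis by (metis M_def inner_eq_zero_iff inner_ge_zero order_antisym)
qed

section \<open>Kernels, coercivity and projections of semidefinite matrices\<close>

text \<open>With \<open>w = A *v v\<close>, the nonnegative form at \<open>v - s *\<^sub>R w\<close>
  has no constant term and linear coefficient \<open>- 2 * (w \<bullet> w)\<close>, which forces
  \<open>w = 0\<close>.\<close>

lemma psd_kernel:
  assumes A: "A \<in> psd_cone" and v: "v \<bullet> (A *v v) = 0"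
  shows "A *v v = 0"
proof -
  have Asym: "A \<in> sym_mats" and nonneg: "\<And>v. v \<bullet> (A *v v) \<ge> 0"
    using A by (auto simp: psd_cone_def)
  define w where "w = A *v v"
  have "w \<bullet> w \<le> 0"
  proof (rule quadratic_coeff_nonpos)
    fix s :: real
    have "(v - s *\<^sub>R w) \<bullet> (A *v (v - s *\<^sub>R w)) = - 2 * s * (w \<bullet> w) + s\<^sup>2 * (w \<bullet> (A *v w))"
      using v sym_mats_inner_commute[OF Asym, of v w]
      by (simp add: matrix_vector_mult_diff_distrib matrix_vector_mult_scaleR inner_diff_left
          inner_diff_right power2_eq_square right_diff_distrib flip: w_def)
    then show "2 * s * (w \<bullet> w) + s\<^sup>2 * - (w \<bullet> (A *v w)) \<le> 0"
      using nonneg[of "v - s *\<^sub>R w"] by linarith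
  qed
  then show ?thesis by (metis w_def inner_eq_zero_iff inner_ge_zero order_antisym)
qed

text \<open>By compactness the form attains a minimum on the unit sphere of the orthogonal
  complement of the kernel. The minimum is positive, since a zero would lie in the kernel and be
  orthogonal to itself.\<close>

lemma psd_coercive_orthogonal_kernel:
  fixes A :: "real^'p^'p"
  assumes A: "A \<in> psd_cone"
  obtains \<alpha> where "\<alpha> > 0"
    "\<And>a. (\<And>n. A *v n = 0 \<Longrightarrow> orthogonal a n) \<Longrightarrow> \<alpha> * (norm a)\<^sup>2 \<le> a \<bullet> (A *v a)"
proof -
  have nonneg: "\<And>v. v \<bullet> (A *v v) \<ge> 0"
    using A by (auto simp: psd_cone_def)
  define S where "S = sphere 0 1 \<inter> (\<Inter>n\<in>{n. A *v n = 0}. {a. n \<bullet> a = 0})"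
  have "compact S"
    unfolding S_def by (intro compact_Int_closed closed_INT compact_sphere ballI closed_hyperplane)
  have cont: "continuous_on S (\<lambda>a. a \<bullet> (A *v a))"
    by (intro continuous_intros linear_continuous_on matrix_vector_mul_bounded_linear)
  obtain \<alpha> where "\<alpha> > 0" and \<alpha>: "\<And>a. a \<in> S \<Longrightarrow> \<alpha> \<le> a \<bullet> (A *v a)"
  proof (cases "S = {}")
    case True
    \<comment> \<open>The complement of the kernel is trivial here, so any positive constant
      serves.\<close>
    with that[of 1] show ?thesis by simp
  next
    case False
    with \<open>compact S\<close> cont obtain x where x: "x \<in> S" "\<And>a. a \<in> S \<Longrightarrow> x \<bullet> (A *v x) \<le> a \<bullet> (A *v a)"
      by (meson continuous_attains_inf)
    have "x \<bullet> (A *v x) \<noteq> 0"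
    proof
      assume "x \<bullet> (A *v x) = 0"
      then have "A *v x = 0" by (rule psd_kernel[OF A])
      then have "x \<bullet> x = 0" "norm x = 1" using x(1) by (auto simp: S_def)
      then show False by simp
    qed
    with nonneg[of x] that[of "x \<bullet> (A *v x)"] x(2) show ?thesis by simp
  qed
  show thesis
  proof (rule that[OF \<open>\<alpha> > 0\<close>])
    fix a assume orth: "\<And>n. A *v n = 0 \<Longrightarrow> orthogonal a n"
    show "\<alpha> * (norm a)\<^sup>2 \<le> a \<bullet> (A *v a)"
    proof (cases "a = 0")
      case False
      then have "a /\<^sub>R norm a \<in> S"
        using orth by (auto simp: S_def orthogonal_def inner_commute)
      from \<alpha>[OF this] False show ?thesis
        by (simp add: matrix_vector_mult_scaleR field_simps power2_eq_square)
    qed simp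
  qed
qed

text \<open>\<open>P\<close> is the sum of the rank-one matrices b b^T over an orthonormal basis.
  The residual \<open>u - P *v u\<close> lies in \<open>U\<close> and is orthogonal to every basis
  vector, hence to itself.\<close>

lemma orthogonal_projection_matrix:
  fixes U :: "(real^'p) set"
  assumes "subspace U"
  obtains P where "P \<in> sym_mats" "\<And>v. P *v v \<in> U" "\<And>u. u \<in> U \<Longrightarrow> P *v u = u"
proof -
  obtain B where B: "B \<subseteq> U" "pairwise orthogonal B" "\<And>x. x \<in> B \<Longrightarrow> norm x = 1"
    "independent B" "span B = U"
    using orthonormal_basis_subspace[OF assms] by metis
  have fin: "finite B" using B(4) independent_imp_finite by blast
  define P :: "real^'p^'p" where "P = (\<chi> i j. \<Sum>b\<in>B. b $ i * b $ j)"
  have P: "P *v v = (\<Sum>b\<in>B. (b \<bullet> v) *\<^sub>R b)" for v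
  proof -
    have "(P *v v) $ i = (\<Sum>b\<in>B. (b \<bullet> v) *\<^sub>R b) $ i" for i
    proof -
      have "(P *v v) $ i = (\<Sum>j\<in>UNIV. \<Sum>b\<in>B. b $ i * b $ j * v $ j)"
        by (simp add: P_def matrix_vector_mult_def sum_distrib_right)
      also have "\<dots> = (\<Sum>b\<in>B. \<Sum>j\<in>UNIV. b $ i * b $ j * v $ j)"
        by (rule sum.swap)
      also have "\<dots> = (\<Sum>b\<in>B. (b \<bullet> v) *\<^sub>R b) $ i"
        by (simp add: inner_vec_def sum_distrib_left sum_distrib_right mult_ac)
      finally show ?thesis .
    qed
    then show ?thesis by (simp add: vec_eq_iff)
  qed
  have inU: "P *v v \<in> U" for v
    unfolding P using B(1) assms by (intro subspace_sum subspace_scale) auto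
  show thesis
  proof (rule that)
    show "P \<in> sym_mats"
      by (simp add: P_def sym_mats_def transpose_def vec_eq_iff mult.commute)
    show "P *v v \<in> U" for v by (rule inU)
    show "P *v u = u" if u: "u \<in> U" for u
    proof -
      have "(u - P *v u) \<bullet> c = 0" if c: "c \<in> B" for c
      proof -
        have "(P *v u) \<bullet> c = (\<Sum>b\<in>B. if b = c then u \<bullet> c else 0)"
          unfolding P inner_sum_left
        proof (rule sum.cong[OF refl])
          fix b assume b: "b \<in> B"
          have "c \<bullet> c = 1" using B(3)[OF c] by (simp add: norm_eq_1)
          then show "(b \<bullet> u) *\<^sub>R b \<bullet> c = (if b = c then u \<bullet> c else 0)"
            using B(2) b c by (auto simp: pairwise_def orthogonal_def inner_commute)
        qed
        also have "\<dots> = u \<bullet> c" using fin c by simp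
        finally show ?thesis by (simp add: inner_diff_left)
      qed
      moreover have "u - P *v u \<in> span B"
        unfolding B(5) by (intro subspace_diff assms u inU)
      ultimately have "orthogonal (u - P *v u) (u - P *v u)"
        using orthogonal_to_span by (metis orthogonal_def)
      then show ?thesis by (simp add: orthogonal_self)
    qed
  qed
qed

section \<open>A second order tangent orthogonal to the multiplier\<close>

lemma subspace_matrix_kernel:
  fixes A :: "real^'n^'m"
  shows "subspace {v. A *v v = 0}"
  by (auto simp: subspace_def matrix_vector_right_distrib matrix_vector_mult_scaleR)

text \<open>
  The quadratic term \<open>c P\<close> absorbs the mixed terms \<open>2 t \<langle>a, H n\<rangle>\<close> between the kernel of \<open>A\<close>
  and its complement, on which \<open>A\<close> is bounded below by \<open>\<alpha>\<close>; this dictates \<open>c = 4 h\<^sup>2 / \<alpha>\<close>.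
\<close>

lemma second_order_tangent_set_witness:
  fixes A H y :: "real^'p^'p"
  assumes A: "A \<in> psd_cone" and H: "H \<in> sym_mats" and y: "y \<in> sym_mats"
    and Ay: "A ** y = 0" and Hy: "H ** y = 0"
    and H_ker: "\<And>n. A *v n = 0 \<Longrightarrow> n \<bullet> (H *v n) \<ge> 0"
  obtains W where "W \<in> second_order_tangent_set A H" "y \<bullet> W = 0"
proof -
  have Asym: "A \<in> sym_mats" using A by (simp add: psd_cone_def)
  obtain \<alpha> where "\<alpha> > 0"
    and \<alpha>: "\<And>a. (\<And>n. A *v n = 0 \<Longrightarrow> orthogonal a n) \<Longrightarrow> \<alpha> * (norm a)\<^sup>2 \<le> a \<bullet> (A *v a)"
    using psd_coercive_orthogonal_kernel[OF A] by metis
  obtain h where "h > 0" and h: "\<And>v. norm (H *v v) \<le> norm v * h"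
    using bounded_linear.pos_bounded[OF matrix_vector_mul_bounded_linear[of H]] by metis
  have hi: "- (h * norm u * norm v) \<le> u \<bullet> (H *v v)" for u v
    using Cauchy_Schwarz_ineq2[of u "H *v v"] mult_left_mono[OF h[of v] norm_ge_zero[of u]]
    by (simp add: mult_ac)
  define U where "U = {u. y *v u = 0}"
  have "subspace U"
    unfolding U_def by (rule subspace_matrix_kernel)
  then obtain P where P: "P \<in> sym_mats" "\<And>v. P *v v \<in> U" "\<And>u. u \<in> U \<Longrightarrow> P *v u = u"
    using orthogonal_projection_matrix by metis
  \<comment> \<open>The range of \<open>S\<close> lies in \<open>U\<close>, the kernel of
    \<open>y\<close>; by symmetry \<open>S\<close> vanishes on the orthogonal complement of
    \<open>U\<close>, which contains \<open>v - P *v v\<close>.\<close>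
  have annihilate: "S *v (v - P *v v) = 0" if S: "S \<in> sym_mats" "S ** y = 0" for S v
  proof -
    have "y ** S = 0"
      using S y matrix_transpose_mul[of S y] by (simp add: sym_mats_def transpose_def vec_eq_iff)
    then have SU: "S *v z \<in> U" for z
      by (simp add: U_def matrix_vector_mul_assoc)
    have "z \<bullet> (S *v (v - P *v v)) = 0" for z
    proof -
      have "(P *v v) \<bullet> (S *v z) = v \<bullet> (S *v z)"
        using sym_mats_inner_commute[OF P(1), of "S *v z" v] P(3)[OF SU[of z]]
        by (metis inner_commute)
      then show ?thesis
        unfolding sym_mats_inner_commute[OF S(1), of z "v - P *v v"] by (simp add: inner_diff_left)
    qed
    then show ?thesis using inner_eq_zero_iff by blast
  qed
  define c where "c = 4 * h\<^sup>2 / \<alpha>"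
  define W where "W = c *\<^sub>R P"
  have "y ** W = 0"
  proof -
    have "y ** P = 0"
      using P(2) by (simp add: matrix_eq U_def flip: matrix_vector_mul_assoc)
    then show ?thesis by (simp add: W_def matrix_scalar_ac flip: scalar_matrix_assoc)
  qed
  then have "y \<bullet> W = 0"
    by (simp add: inner_sym_mats_eq_trace[OF y] trace_def)
  \<comment> \<open>The bound on \<open>t\<close> keeps \<open>\<alpha> / 2 - t * h\<close>
    nonnegative, as required once the square is completed.\<close>
  have psd: "A + t *\<^sub>R H + (t\<^sup>2 / 2) *\<^sub>R W \<in> psd_cone" if t: "0 < t" "t < \<alpha> / (2 * h)" for t
  proof -
    define M where "M = A + t *\<^sub>R H + (t\<^sup>2 / 2) *\<^sub>R W"
    have Msym: "M \<in> sym_mats"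
      unfolding M_def W_def
      by (intro subspace_add subspace_scale subspace_sym_mats Asym H P(1))
    have M: "M *v v = A *v v + t *\<^sub>R (H *v v) + (t\<^sup>2 / 2 * c) *\<^sub>R (P *v v)" for v
      by (simp add: M_def W_def matrix_vector_mult_add_rdistrib scaleR_matrix_vector_assoc)
    have "v \<bullet> (M *v v) \<ge> 0" for v
    proof -
      \<comment> \<open>\<open>A\<close>, \<open>H\<close> and \<open>P\<close> all annihilate
        \<open>v - u\<close>, so the form of \<open>M\<close> at \<open>v\<close> equals its form at
        \<open>u\<close>, where \<open>P\<close> acts as the identity.\<close>
      define u where "u = P *v v"
      have Pu: "P *v u = u" using P(2,3) by (simp add: u_def)
      have "M *v (v - u) = 0"
        unfolding M using annihilate[OF Asym Ay, of v] annihilate[OF H Hy, of v] Pu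
        by (simp add: matrix_vector_mult_diff_distrib flip: u_def)
      then have "M *v v = M *v u" by (simp add: matrix_vector_mult_diff_distrib)
      then have vu: "v \<bullet> (M *v v) = u \<bullet> (M *v u)"
        using sym_mats_inner_commute[OF Msym, of v u] by simp
      have span: "span {n. A *v n = 0} = {n. A *v n = 0}"
        using subspace_matrix_kernel[of A] by (simp only: span_eq_iff)
      obtain n a where "n \<in> span {n. A *v n = 0}"
        and orth: "\<And>w. w \<in> span {n. A *v n = 0} \<Longrightarrow> orthogonal a w" and una: "u = n + a"
        by (rule orthogonal_subspace_decomp_exists[of "{n. A *v n = 0}" u]) blast
      then have n: "A *v n = 0" and a: "\<And>w. A *v w = 0 \<Longrightarrow> orthogonal a w"
        unfolding span by blast+
      have na: "n \<bullet> a = 0" using a[OF n] by (simp add: orthogonal_def inner_commute)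
      have nAa: "n \<bullet> (A *v a) = 0" using sym_mats_inner_commute[OF Asym, of n a] n by simp
      have nHa: "n \<bullet> (H *v a) = a \<bullet> (H *v n)" by (rule sym_mats_inner_commute[OF H])
      define r s where "r = norm a" and "s = norm n"
      have "u \<bullet> (M *v u) = a \<bullet> (A *v a) + t * (n \<bullet> (H *v n) + 2 * (a \<bullet> (H *v n)) + a \<bullet> (H *v a))
          + t\<^sup>2 / 2 * c * (s\<^sup>2 + r\<^sup>2)"
        unfolding M Pu
        using n na nAa nHa by (simp add: una matrix_vector_right_distrib inner_add_left inner_add_right
            r_def s_def power2_norm_eq_inner inner_commute[of a n] algebra_simps)
      moreover have "\<alpha> * r\<^sup>2 \<le> a \<bullet> (A *v a)" using \<alpha>[OF a] by (simp add: r_def)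
      moreover have "t * (- (2 * h * r * s) - h * r\<^sup>2)
          \<le> t * (n \<bullet> (H *v n) + 2 * (a \<bullet> (H *v n)) + a \<bullet> (H *v a))"
        using H_ker[OF n] hi[of a n] hi[of a a] t
        by (intro mult_left_mono) (auto simp: r_def s_def power2_eq_square)
      moreover have "t\<^sup>2 / 2 * c * s\<^sup>2 \<le> t\<^sup>2 / 2 * c * (s\<^sup>2 + r\<^sup>2)"
        using \<open>\<alpha> > 0\<close> by (intro mult_left_mono) (auto simp: c_def)
      \<comment> \<open>Half of the coercive term completes the square, which the choice of
        \<open>c\<close> makes exact; the other half covers
        \<open>- t * h * r\<^sup>2\<close>.\<close>
      moreover have "\<alpha> * r\<^sup>2 + t * (- (2 * h * r * s) - h * r\<^sup>2) + t\<^sup>2 / 2 * c * s\<^sup>2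
          = \<alpha> / 2 * (r - 2 * h * t / \<alpha> * s)\<^sup>2 + (\<alpha> / 2 - t * h) * r\<^sup>2"
        using \<open>\<alpha> > 0\<close> by (simp add: c_def field_simps power2_eq_square)
      moreover have "\<dots> \<ge> 0"
        using t \<open>\<alpha> > 0\<close> \<open>h > 0\<close> by (intro add_nonneg_nonneg mult_nonneg_nonneg) (auto simp: field_simps)
      ultimately show ?thesis unfolding vu by linarith
    qed
    with Msym show ?thesis by (simp add: psd_cone_def M_def)
  qed
  have "\<forall>\<^sub>F t in at_right 0. t < \<alpha> / (2 * h)"
    using \<open>\<alpha> > 0\<close> \<open>h > 0\<close> by (intro eventually_at_rightI[of 0 "\<alpha> / (2 * h)"]) auto
  \<comment> \<open>The curve lies in the cone for small positive \<open>t\<close>, so its distance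
    to the cone is eventually zero and trivially of order \<open>o(t\<^sup>2)\<close>.\<close>
  then have "\<forall>\<^sub>F t in at_right 0. infdist (A + t *\<^sub>R H + (t\<^sup>2 / 2) *\<^sub>R W) psd_cone = 0"
    using eventually_at_right_less[of "0::real"] by eventually_elim (simp add: psd)
  then have "W \<in> second_order_tangent_set A H"
    unfolding second_order_tangent_set_def W_def
    using landau_o.small.in_cong subspace_scale[OF subspace_sym_mats P(1)] by fastforce
  with \<open>y \<bullet> W = 0\<close> that show thesis by blast
qed

section \<open>Complementarity and feasibility from the normal cones\<close>

lemma congruence_psd_cone:
  assumes "X \<in> psd_cone" shows "transpose M ** X ** M \<in> psd_cone"
  using assms
  by (simp add: psd_cone_def sym_mats_def matrix_transpose_mul matrix_mul_assoc)
    (metis dot_lmul_matrix matrix_vector_mul_assoc transpose_matrix_vector inner_commute)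

lemma congruence_nsd_cone:
  assumes "X \<in> nsd_cone" shows "transpose M ** X ** M \<in> nsd_cone"
  using assms
  by (simp add: nsd_cone_def sym_mats_def matrix_transpose_mul matrix_mul_assoc)
    (metis dot_lmul_matrix matrix_vector_mul_assoc transpose_matrix_vector inner_commute)

text \<open>Congruences of \<open>Z\<close> stay in the cone, so the normal inequality may be tested
  along them.\<close>

lemma normal_cone_psd_complementarity:
  assumes "y \<in> normal_cone sym_mats Z psd_cone"
  shows "Z ** y = 0"
proof (rule mult_eq_0_if_congruences_le)
  show "y \<in> sym_mats" "Z \<in> sym_mats"
    using assms by (auto simp: normal_cone_def psd_cone_def)
  show "y \<bullet> (transpose M ** Z ** M - Z) \<le> 0" for M
    using assms congruence_psd_cone by (auto simp: normal_cone_def)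
qed

text \<open>The congruence argument with base point \<open>y\<close> and normal \<open>Z\<close>
  gives \<open>y ** Z = 0\<close>; transposition reverses the order of the two symmetric
  factors.\<close>

lemma normal_cone_nsd_complementarity:
  assumes "Z \<in> normal_cone sym_mats y nsd_cone"
  shows "Z ** y = 0"
proof -
  have "y ** Z = 0"
  proof (rule mult_eq_0_if_congruences_le)
    show "Z \<in> sym_mats" "y \<in> sym_mats"
      using assms by (auto simp: normal_cone_def nsd_cone_def)
    show "Z \<bullet> (transpose M ** y ** M - y) \<le> 0" for M
      using assms congruence_nsd_cone by (auto simp: normal_cone_def)
  qed
  moreover have "transpose (y ** Z) = Z ** y"
    using assms by (simp add: matrix_transpose_mul normal_cone_def nsd_cone_def sym_mats_def)
  ultimately show ?thesis by (simp add: transpose_def vec_eq_iff)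
qed

text \<open>Subtracting v v^T keeps \<open>y\<close> negative semidefinite, and the normal
  inequality at that point reads \<open>v \<bullet> (Z *v v) \<ge> 0\<close>. For a perturbed KKT
  point this places \<open>G x + p2\<close> in the positive semidefinite cone.\<close>

lemma normal_cone_nsd_imp_psd:
  assumes Z: "Z \<in> normal_cone sym_mats y nsd_cone"
  shows "Z \<in> psd_cone"
proof -
  have y: "y \<in> nsd_cone" using Z by (simp add: normal_cone_def)
  have "v \<bullet> (Z *v v) \<ge> 0" for v
  proof -
    define V :: "real^'a^'a" where "V = (\<chi> i j. v $ i * v $ j)"
    have V: "V *v w = (v \<bullet> w) *\<^sub>R v" for w
      by (simp add: V_def matrix_vector_mult_def vec_eq_iff inner_vec_def sum_distrib_left
          sum_distrib_right mult_ac)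
    have "V \<in> sym_mats"
      by (simp add: V_def sym_mats_def transpose_def vec_eq_iff mult.commute)
    then have "y - V \<in> nsd_cone"
      using y subspace_diff[OF subspace_sym_mats, of y V]
      by (auto simp: nsd_cone_def matrix_vector_mult_diff_rdistrib inner_diff_right V inner_commute
          intro: order_trans[OF _ zero_le_square])
    then have "Z \<bullet> (y - V - y) \<le> 0" using Z unfolding normal_cone_def by blast
    moreover have "Z \<bullet> V = v \<bullet> (Z *v v)"
      by (simp add: V_def inner_vec_def matrix_vector_mult_def sum_distrib_left mult_ac)
    ultimately show ?thesis by simp
  qed
  then show ?thesis using Z by (simp add: psd_cone_def normal_cone_def)
qed

section \<open>Difference quotients and gradients\<close>

text \<open>The Frechet remainder divided by the norm vanishes along the sequence; what is left is
  \<open>F'\<close> at the normalized displacement, which converges by continuity.\<close>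

lemma has_derivative_difference_quotient:
  fixes F :: "'a::real_normed_vector \<Rightarrow> 'b::real_normed_vector"
  assumes F: "(F has_derivative F') (at a)"
    and x: "x \<longlonglongrightarrow> a" and ne: "\<And>k. x k \<noteq> a"
    and d: "(\<lambda>k. (x k - a) /\<^sub>R norm (x k - a)) \<longlonglongrightarrow> d"
  shows "(\<lambda>k. (F (x k) - F a) /\<^sub>R norm (x k - a)) \<longlonglongrightarrow> F' d"
proof -
  have bl: "bounded_linear F'" using F by (rule has_derivative_bounded_linear)
  have "((\<lambda>y. (F y - F a - F' (y - a)) /\<^sub>R norm (y - a)) \<longlongrightarrow> 0) (at a)"
    using F by (simp add: has_derivative_at_within)
  moreover have "filterlim x (at a) sequentially"
    using x ne by (simp add: filterlim_at)
  ultimately have "(\<lambda>k. (F (x k) - F a - F' (x k - a)) /\<^sub>R norm (x k - a)) \<longlonglongrightarrow> 0"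
    by (rule filterlim_compose)
  moreover have "(\<lambda>k. F' ((x k - a) /\<^sub>R norm (x k - a))) \<longlonglongrightarrow> F' d"
    using bounded_linear.tendsto[OF bl d] .
  ultimately have "(\<lambda>k. (F (x k) - F a - F' (x k - a)) /\<^sub>R norm (x k - a)
      + F' ((x k - a) /\<^sub>R norm (x k - a))) \<longlonglongrightarrow> 0 + F' d"
    by (rule tendsto_add)
  moreover have "(F (x k) - F a - F' (x k - a)) /\<^sub>R norm (x k - a) + F' ((x k - a) /\<^sub>R norm (x k - a))
      = (F (x k) - F a) /\<^sub>R norm (x k - a)" for k
    unfolding linear_cmul[OF bounded_linear.linear[OF bl]]
    by (simp flip: scaleR_add_right)
  ultimately show ?thesis by simp
qed

text \<open>Coordinate form of the Riesz representation, used to write down gradients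
  explicitly.\<close>

lemma inner_sum_Basis_linear:
  fixes g :: "'a::euclidean_space \<Rightarrow> real"
  assumes "linear g"
  shows "h \<bullet> (\<Sum>b\<in>Basis. g b *\<^sub>R b) = g h"
proof -
  have "g h = g (\<Sum>b\<in>Basis. (h \<bullet> b) *\<^sub>R b)" by (simp add: euclidean_representation)
  also have "\<dots> = (\<Sum>b\<in>Basis. (h \<bullet> b) * g b)"
    using assms by (simp add: linear_sum linear_cmul)
  finally show ?thesis by (simp add: inner_sum_right mult.commute)
qed

text \<open>Ties \<open>grad\<close> and \<open>hess\<close> to actual derivatives: the gradient is
  a finite basis sum in \<open>f'\<close> and \<open>G'\<close> and can be differentiated termwise.
  Stating it through inner products exhibits its affine dependence on \<open>y\<close>.\<close>

lemma twice_cont_diff_lagrangian_gradient: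
  fixes f :: "real^'n \<Rightarrow> real" and G :: "real^'n \<Rightarrow> real^'p^'p"
  assumes f: "twice_cont_diff f" and G: "twice_cont_diff G"
  obtains G' :: "real^'n \<Rightarrow> (real^'n) \<Rightarrow>\<^sub>L (real^'p^'p)"
  where "\<And>x. (G has_derivative blinfun_apply (G' x)) (at x)" "continuous_on UNIV G'"
    "\<And>x y h. grad (\<lambda>x. lagrangian f G x y) x \<bullet> h = frechet_derivative f (at x) h + y \<bullet> G' x h"
    "\<And>x y. (grad (\<lambda>x. lagrangian f G x y) has_derivative hess (\<lambda>x. lagrangian f G x y) x) (at x)"
proof -
  obtain f' :: "real^'n \<Rightarrow> (real^'n) \<Rightarrow>\<^sub>L real" and f''
    where f': "\<And>x. (f has_derivative blinfun_apply (f' x)) (at x)"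
      and f'': "\<And>x. (f' has_derivative blinfun_apply (f'' x)) (at x)"
    using f unfolding twice_cont_diff_def by blast
  obtain G' :: "real^'n \<Rightarrow> (real^'n) \<Rightarrow>\<^sub>L (real^'p^'p)" and G''
    where G': "\<And>x. (G has_derivative blinfun_apply (G' x)) (at x)"
      and G'': "\<And>x. (G' has_derivative blinfun_apply (G'' x)) (at x)"
    using G unfolding twice_cont_diff_def by blast
  define D where "D y x = (\<Sum>b\<in>Basis. (f' x b + y \<bullet> G' x b) *\<^sub>R b)" for y x
  have D: "h \<bullet> D y x = f' x h + y \<bullet> G' x h" for h y x
    unfolding D_def
    by (rule inner_sum_Basis_linear, rule linearI)
      (simp_all add: blinfun.add_right blinfun.scaleR_right inner_add_right algebra_simps)
  have grad: "grad (\<lambda>x. lagrangian f G x y) x = D y x" for x y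
  proof (rule grad_eq)
    show "GDERIV (\<lambda>x. lagrangian f G x y) x :> D y x"
      unfolding gderiv_def lagrangian_def D
      by (intro has_derivative_add f' has_derivative_inner_right G')
  qed
  show thesis
  proof (rule that[of G'])
    show "\<And>x. (G has_derivative blinfun_apply (G' x)) (at x)" by (rule G')
    show "continuous_on UNIV G'"
      using G'' by (meson continuous_at_imp_continuous_on has_derivative_continuous)
    show "grad (\<lambda>x. lagrangian f G x y) x \<bullet> h = frechet_derivative f (at x) h + y \<bullet> G' x h" for x y h
      using D[of h y x] frechet_derivative_at[OF f'[of x]] by (simp add: grad inner_commute)
    show "(grad (\<lambda>x. lagrangian f G x y) has_derivative hess (\<lambda>x. lagrangian f G x y) x) (at x)" for x y
    proof -
      have "grad (\<lambda>x. lagrangian f G x y) = D y" using grad by blast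
      moreover have "(D y has_derivative
          (\<lambda>h. \<Sum>b\<in>Basis. (f'' x h b + y \<bullet> G'' x h b) *\<^sub>R b)) (at x)"
        unfolding D_def
        by (intro has_derivative_sum has_derivative_scaleR_left has_derivative_add
            has_derivative_inner_right
            bounded_linear.has_derivative[OF blinfun.bounded_linear_left] f'' G'')
      ultimately have "grad (\<lambda>x. lagrangian f G x y) differentiable (at x)"
        by (simp add: differentiableI)
      then show ?thesis
        unfolding hess_def by (rule frechet_derivative_works[THEN iffD1])
    qed
  qed
qed

section \<open>Sequences of perturbed KKT points\<close>

text \<open>The hypotheses are the normalized form of a failing estimate: the displacement has a
  limiting direction \<open>d\<close>, and all other deviations are of smaller order.\<close>

lemma no_critical_KKT_sequence:
  fixes f :: "real^'n \<Rightarrow> real" and G :: "real^'n \<Rightarrow> real^'p^'p"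
    and x p1 :: "nat \<Rightarrow> real^'n" and y p2 :: "nat \<Rightarrow> real^'p^'p"
  assumes f_C2: "twice_cont_diff f" and G_C2: "twice_cont_diff G"
    and multiplier: "ybar \<in> multipliers f G xbar"
    and SOSC: "second_order_sufficient f G xbar ybar"
    and KKT: "\<And>k. (x k, y k) \<in> S_KKT f G (p1 k) (p2 k)"
    and x: "x \<longlonglongrightarrow> xbar" and ne: "\<And>k. x k \<noteq> xbar"
    and d: "(\<lambda>k. (x k - xbar) /\<^sub>R norm (x k - xbar)) \<longlonglongrightarrow> d"
    and p1: "(\<lambda>k. p1 k /\<^sub>R norm (x k - xbar)) \<longlonglongrightarrow> 0"
    and p2: "(\<lambda>k. p2 k /\<^sub>R norm (x k - xbar)) \<longlonglongrightarrow> 0"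
    and y: "(\<lambda>k. (y k - ybar) /\<^sub>R norm (x k - xbar)) \<longlonglongrightarrow> 0"
  shows False
proof -
  define t where "t k = norm (x k - xbar)" for k
  have t_pos: "t k > 0" for k using ne by (simp add: t_def)
  have t0: "t \<longlonglongrightarrow> 0"
    unfolding t_def using x by (simp add: LIM_zero tendsto_norm_zero)
  note d = d[folded t_def] and p1 = p1[folded t_def] and p2 = p2[folded t_def] and y = y[folded t_def]
  obtain G' :: "real^'n \<Rightarrow> (real^'n) \<Rightarrow>\<^sub>L (real^'p^'p)"
    where G': "\<And>x. (G has_derivative blinfun_apply (G' x)) (at x)" and G'_cont: "continuous_on UNIV G'"
    and grad: "\<And>x y h. grad (\<lambda>x. lagrangian f G x y) x \<bullet> h = frechet_derivative f (at x) h + y \<bullet> G' x h"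
    and hess: "\<And>x y. (grad (\<lambda>x. lagrangian f G x y) has_derivative hess (\<lambda>x. lagrangian f G x y) x) (at x)"
    using twice_cont_diff_lagrangian_gradient[OF f_C2 G_C2] by metis
  define A where "A = G xbar"
  define H where "H = G' xbar d"
  define Z where "Z k = G (x k) + p2 k" for k
  let ?gL = "grad (\<lambda>x. lagrangian f G x ybar)" and ?hL = "hess (\<lambda>x. lagrangian f G x ybar) xbar"
  have frG: "frechet_derivative G (at xbar) = G' xbar"
    by (rule frechet_derivative_at[OF G', symmetric])
  have ybar_sym: "ybar \<in> sym_mats" and gL0: "?gL xbar = 0"
    and ybar_normal: "ybar \<in> normal_cone sym_mats A psd_cone"
    using multiplier by (auto simp: multipliers_def A_def)
  have A_psd: "A \<in> psd_cone" and A_ybar: "A ** ybar = 0"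
    using ybar_normal normal_cone_psd_complementarity by (auto simp: normal_cone_def)
  have Z_normal: "Z k \<in> normal_cone sym_mats (y k) nsd_cone"
    and p1_eq: "p1 k = grad (\<lambda>x. lagrangian f G x (y k)) (x k)" for k
    using KKT[of k] by (auto simp: S_KKT_def Z_def algebra_simps)
  have Z_psd: "Z k \<in> psd_cone" and Zy: "Z k ** y k = 0" for k
    using Z_normal normal_cone_nsd_imp_psd normal_cone_nsd_complementarity by blast+
  have y_lim: "y \<longlonglongrightarrow> ybar"
  proof -
    have "(\<lambda>k. t k *\<^sub>R ((y k - ybar) /\<^sub>R t k) + ybar) \<longlonglongrightarrow> 0 *\<^sub>R 0 + ybar"
      by (intro tendsto_intros t0 y)
    moreover have "t k *\<^sub>R ((y k - ybar) /\<^sub>R t k) + ybar = y k" for k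
      using t_pos[of k] by simp
    ultimately show ?thesis by simp
  qed
  have ZH: "(\<lambda>k. (Z k - A) /\<^sub>R t k) \<longlonglongrightarrow> H"
  proof -
    have "(\<lambda>k. (G (x k) - G xbar) /\<^sub>R t k) \<longlonglongrightarrow> H"
      unfolding t_def H_def using d[unfolded t_def]
      by (rule has_derivative_difference_quotient[OF G' x ne])
    from tendsto_add[OF this p2] show ?thesis
      by (simp add: Z_def A_def algebra_simps)
  qed
  have H_sym: "H \<in> sym_mats"
  proof (rule closed_sequentially[OF closed_subspace[OF subspace_sym_mats] _ ZH])
    show "(Z k - A) /\<^sub>R t k \<in> sym_mats" for k
      using Z_psd A_psd
      by (auto simp: psd_cone_def intro!: subspace_scale[OF subspace_sym_mats] subspace_diff[OF subspace_sym_mats])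
  qed
  \<comment> \<open>On the kernel of \<open>A\<close> only \<open>Z k\<close> contributes to the
    difference quotient, and its form is nonnegative.\<close>
  have H_ker: "n \<bullet> (H *v n) \<ge> 0" if n: "A *v n = 0" for n
  proof (rule LIMSEQ_le_const)
    have "bounded_linear (\<lambda>M. n \<bullet> (M *v n))"
      by (intro linear_conv_bounded_linear[THEN iffD1] linearI)
        (simp_all add: matrix_vector_mult_add_rdistrib inner_add_right flip: scaleR_matrix_vector_assoc)
    from bounded_linear.tendsto[OF this ZH]
    show "(\<lambda>k. n \<bullet> (((Z k - A) /\<^sub>R t k) *v n)) \<longlonglongrightarrow> n \<bullet> (H *v n)" .
    have "0 \<le> n \<bullet> (((Z k - A) /\<^sub>R t k) *v n)" for k
      using Z_psd[of k] t_pos[of k] n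
      by (simp add: psd_cone_def matrix_vector_mult_diff_rdistrib flip: scaleR_matrix_vector_assoc)
    then show "\<exists>N. \<forall>k\<ge>N. 0 \<le> n \<bullet> (((Z k - A) /\<^sub>R t k) *v n)" by blast
  qed
  have H_ybar: "H ** ybar = 0"
  proof (rule LIMSEQ_unique)
    have "bounded_bilinear ((**) :: real^'p^'p \<Rightarrow> real^'p^'p \<Rightarrow> real^'p^'p)"
      by (intro bilinear_conv_bounded_bilinear[THEN iffD1])
        (auto simp: bilinear_def matrix_add_ldistrib matrix_add_rdistrib matrix_scalar_ac
          intro!: linearI simp flip: scalar_matrix_assoc)
    note bb = bounded_bilinear.tendsto[OF this]
    have "(\<lambda>k. ((Z k - A) /\<^sub>R t k) ** y k + A ** ((y k - ybar) /\<^sub>R t k)) \<longlonglongrightarrow> H ** ybar + A ** 0"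
      by (intro tendsto_add bb ZH y_lim tendsto_const y)
    \<comment> \<open>Up to scaling the sum telescopes to \<open>Z k ** y k - A ** ybar\<close>,
      where both products vanish by complementarity.\<close>
    moreover have "((Z k - A) /\<^sub>R t k) ** y k + A ** ((y k - ybar) /\<^sub>R t k) = 0" for k
    proof -
      have "(Z k - A) ** y k + A ** (y k - ybar) = 0"
        using Zy[of k] A_ybar matrix_add_rdistrib[of "Z k - A" A "y k"]
          matrix_add_ldistrib[of A "y k - ybar" ybar] by simp
      then show ?thesis
        by (simp add: matrix_scalar_ac flip: scalar_matrix_assoc scaleR_add_right)
    qed
    moreover have "A ** (0 :: real^'p^'p) = 0" by (simp add: matrix_matrix_mult_def zero_vec_def)
    ultimately show "(\<lambda>k. 0) \<longlonglongrightarrow> H ** ybar" by simp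
    show "(\<lambda>k. 0 :: real^'p^'p) \<longlonglongrightarrow> 0" by simp
  qed
  have "norm d = 1"
  proof (rule LIMSEQ_unique)
    show "(\<lambda>k. norm ((x k - xbar) /\<^sub>R t k)) \<longlonglongrightarrow> norm d" by (intro tendsto_norm d)
    show "(\<lambda>k. norm ((x k - xbar) /\<^sub>R t k)) \<longlonglongrightarrow> 1"
      using ne by (simp add: t_def)
  qed
  then have "d \<noteq> 0" by auto
  have "H \<in> tangent_cone A psd_cone"
    unfolding tangent_cone_def outer_limit_def using t_pos t0 ZH Z_psd by blast
  \<comment> \<open>Stationarity reduces this derivative to \<open>- (ybar \<bullet> H)\<close>, a
    trace that vanishes because \<open>H ** ybar = 0\<close>.\<close>
  moreover have "frechet_derivative f (at xbar) d = 0"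
  proof -
    have "ybar \<bullet> H = trace (ybar ** H)" by (rule inner_sym_mats_eq_trace[OF ybar_sym])
    also have "\<dots> = trace (H ** ybar)" by (rule trace_mul_sym)
    also have "\<dots> = 0" unfolding H_ybar by (simp add: trace_def)
    finally show ?thesis using grad[of ybar xbar d] gL0 by (simp add: H_def)
  qed
  ultimately have "d \<in> critical_cone f G xbar"
    by (simp add: critical_cone_def frG H_def A_def)
  with \<open>d \<noteq> 0\<close> SOSC
  have sosc: "ereal (d \<bullet> ?hL d) - support_fun ybar (second_order_tangent_set A H) > 0"
    by (auto simp: second_order_sufficient_def frG H_def A_def)
  \<comment> \<open>As the gradient is affine in the multiplier, replacing \<open>y k\<close> by
    \<open>ybar\<close> leaves \<open>p1 k\<close> minus a term in \<open>y k - ybar\<close>, both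
    of smaller order than \<open>t k\<close>.\<close>
  have "?hL d \<bullet> d = 0"
  proof (rule LIMSEQ_unique)
    have "(\<lambda>k. (?gL (x k) - ?gL xbar) /\<^sub>R t k) \<longlonglongrightarrow> ?hL d"
      unfolding t_def using d[unfolded t_def]
      by (rule has_derivative_difference_quotient[OF hess x ne])
    then show "(\<lambda>k. ((?gL (x k) - ?gL xbar) /\<^sub>R t k) \<bullet> d) \<longlonglongrightarrow> ?hL d \<bullet> d"
      by (intro tendsto_inner tendsto_const)
    have "isCont G' xbar" using G'_cont by (simp add: continuous_on_eq_continuous_at)
    then have "(\<lambda>k. G' (x k)) \<longlonglongrightarrow> G' xbar" using x by (rule isCont_tendsto_compose)
    then have "(\<lambda>k. (p1 k /\<^sub>R t k) \<bullet> d - ((y k - ybar) /\<^sub>R t k) \<bullet> G' (x k) d) \<longlonglongrightarrow> 0 \<bullet> d - 0 \<bullet> G' xbar d"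
      by (intro tendsto_intros p1 y)
    moreover have "(p1 k /\<^sub>R t k) \<bullet> d - ((y k - ybar) /\<^sub>R t k) \<bullet> G' (x k) d
        = ((?gL (x k) - ?gL xbar) /\<^sub>R t k) \<bullet> d" for k
      using t_pos[of k] by (simp add: p1_eq gL0 grad inner_diff_left field_simps)
    ultimately show "(\<lambda>k. ((?gL (x k) - ?gL xbar) /\<^sub>R t k) \<bullet> d) \<longlonglongrightarrow> 0" by simp
  qed
  moreover obtain W where "W \<in> second_order_tangent_set A H" "ybar \<bullet> W = 0"
    using second_order_tangent_set_witness[OF A_psd H_sym ybar_sym A_ybar H_ybar H_ker] by metis
  then have "support_fun ybar (second_order_tangent_set A H) \<ge> 0"
    unfolding support_fun_def by (metis SUP_upper zero_ereal_def)
  \<comment> \<open>The support value is nonnegative: if finite, the difference is at most zero; if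
    infinite, the difference is minus infinity.\<close>
  ultimately show False
    using sosc by (cases "support_fun ybar (second_order_tangent_set A H)") (auto simp: inner_commute zero_ereal_def)
qed

section \<open>Reduction of the local estimate to sequences\<close>

theorem theorem4p2:
  fixes f :: "real^'n \<Rightarrow> real"
    and G :: "real^'n \<Rightarrow> real^'p^'p"
    and xbar :: "real^'n"
    and ybar :: "real^'p^'p"
  assumes f_C2: "twice_cont_diff f"
    and G_C2: "twice_cont_diff G"
    and G_sym: "\<And>x. G x \<in> sym_mats"
    and stationary: "stationary f G xbar"
    and multiplier: "ybar \<in> multipliers f G xbar"
    and SOSC: "second_order_sufficient f G xbar ybar"
  shows "\<exists>\<epsilon>>0. \<exists>l>0. \<exists>U W.
    open U \<and> 0 \<in> U \<and> openin (top_of_set sym_mats) W \<and> 0 \<in> W \<and>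
    (\<forall>p1\<in>U. \<forall>p2\<in>W. \<forall>(x, y) \<in> S_KKT f G p1 p2 \<inter> cball (xbar, ybar) \<epsilon>.
       norm (x - xbar) \<le> l * (norm p1 + norm p2 + norm (y - ybar)))"
proof -
  \<comment> \<open>One index \<open>k\<close> gives both the radius and the constant, so failure
    for every \<open>k\<close> yields a sequence converging to \<open>xbar\<close> whose other
    deviations are of smaller order.\<close>
  have "\<exists>k::nat. \<forall>x y p1 p2. (x, y) \<in> S_KKT f G p1 p2 \<longrightarrow> dist xbar x \<le> inverse (Suc k) \<longrightarrow>
      norm (x - xbar) \<le> Suc k * (norm p1 + norm p2 + norm (y - ybar))"
  proof (rule ccontr)
    assume "\<not> ?thesis"
    then obtain x y p1 p2 where KKT: "\<And>k. (x k, y k) \<in> S_KKT f G (p1 k) (p2 k)"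
      and dist: "\<And>k. dist xbar (x k) \<le> inverse (Suc k)"
      and big: "\<And>k. norm (x k - xbar) > Suc k * (norm (p1 k) + norm (p2 k) + norm (y k - ybar))"
      unfolding not_ex not_all not_imp not_le by metis
    have ne: "x k \<noteq> xbar" for k
    proof -
      have "Suc k * (norm (p1 k) + norm (p2 k) + norm (y k - ybar)) \<ge> 0" by simp
      with big[of k] have "norm (x k - xbar) > 0" by linarith
      then show ?thesis by simp
    qed
    have inv0: "(\<lambda>k. inverse (real (Suc k))) \<longlonglongrightarrow> 0" by (rule LIMSEQ_inverse_real_of_nat)
    have x: "x \<longlonglongrightarrow> xbar"
      using Lim_null_comparison[of "\<lambda>k. x k - xbar", OF _ inv0] dist
      by (simp add: LIM_zero_iff dist_norm norm_minus_commute)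
    \<comment> \<open>A generic \<open>u\<close> covers \<open>p1\<close>, \<open>p2\<close> and
      \<open>y - ybar\<close>, whose types differ; the failed estimate bounds the quotient by
      \<open>inverse (Suc k)\<close>.\<close>
    have small: "(\<lambda>k. u k /\<^sub>R norm (x k - xbar)) \<longlonglongrightarrow> 0"
      if u: "\<And>k. norm (u k) \<le> norm (p1 k) + norm (p2 k) + norm (y k - ybar)" for u :: "nat \<Rightarrow> 'c::real_normed_vector"
    proof (rule Lim_null_comparison[OF _ inv0], rule always_eventually, rule allI)
      fix k
      have "Suc k * norm (u k) \<le> norm (x k - xbar)"
        using big[of k] mult_left_mono[OF u[of k], of "Suc k"] by linarith
      then show "norm (u k /\<^sub>R norm (x k - xbar)) \<le> inverse (real (Suc k))"
        using ne[of k] by (simp add: field_simps)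
    qed
    have "\<forall>k. (x k - xbar) /\<^sub>R norm (x k - xbar) \<in> sphere 0 1"
      using ne by simp
    then obtain d r where r: "strict_mono (r :: nat \<Rightarrow> nat)"
      and d: "((\<lambda>k. (x k - xbar) /\<^sub>R norm (x k - xbar)) \<circ> r) \<longlonglongrightarrow> d"
      by (rule seq_compactE[OF compact_imp_seq_compact[OF compact_sphere]])
    note sub = LIMSEQ_subseq_LIMSEQ[OF _ r, unfolded o_def]
    show False
      by (rule no_critical_KKT_sequence[OF f_C2 G_C2 multiplier SOSC KKT, of r d])
        (use ne d sub[OF x] in \<open>auto simp: o_def intro!: sub small\<close>)
  qed
  then obtain k :: nat where k: "\<And>x y p1 p2. (x, y) \<in> S_KKT f G p1 p2 \<Longrightarrow> dist xbar x \<le> inverse (Suc k) \<Longrightarrow>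
      norm (x - xbar) \<le> Suc k * (norm p1 + norm p2 + norm (y - ybar))"
    by blast
  show ?thesis
  proof (intro exI conjI ballI)
    show "inverse (real (Suc k)) > 0" "real (Suc k) > 0" by simp_all
    \<comment> \<open>The bound from \<open>k\<close> is uniform in the perturbations, so the whole
      spaces serve as neighborhoods.\<close>
    show "open (UNIV :: (real^'n) set)" "0 \<in> (UNIV :: (real^'n) set)"
      "openin (top_of_set sym_mats) (sym_mats :: (real^'p^'p) set)"
      by simp_all
    show "0 \<in> (sym_mats :: (real^'p^'p) set)" by (rule subspace_0[OF subspace_sym_mats])
    fix p1 p2 z
    assume z: "z \<in> S_KKT f G p1 p2 \<inter> cball (xbar, ybar) (inverse (real (Suc k)))"
    obtain x y where "z = (x, y)" by fastforce
    moreover have "dist xbar x \<le> inverse (real (Suc k))"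
      using z dist_fst_le[of "(xbar, ybar)" z] \<open>z = (x, y)\<close> by simp
    ultimately show "case z of (x, y) \<Rightarrow>
        norm (x - xbar) \<le> real (Suc k) * (norm p1 + norm p2 + norm (y - ybar))"
      using z k by simp
  qed
qed

end
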